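(* Let $M>0$, let $(\gamma_m)_{m\ge 2}$ and $(\delta_m)_{m\ge2}$ be real sequences with $\gamma_m,\delta_m\ge \alpha_2:=\min\{\gamma_2,\delta_2\}>0$ for all $m\ge 2$, and let $f(z)=z+\sum_{m=2}^{\infty}a_m z^m+\overline{\sum_{m=2}^{\infty}b_m z^m}$ belong to $\mathcal{S}^0_{h+\bar g}(M)$. Then $$|z|+\sum_{m=2}^\infty(|a_m|+|b_m|)|z|^m\le d(f(0),\partial f(\mathbb{D}))$$ for $|z|\le r^*$, where $$r^*=\frac{-1+\sqrt{1+4\left(\frac{M}{\alpha_2}\right)\left(1-\frac{M}{\alpha_2}\right)}}{2\left(\frac{M}{\alpha_2}\right)}.$$ The Bohr radius $r^*$ is achieved by the function $f(z)=z-\frac{M}{\alpha_2}z^2$.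
   Context: $\mathbb{D}=\{z\in\mathbb{C}:|z|<1\}$; $d(f(0),\partial f(\mathbb{D}))$ is the Euclidean distance from $f(0)$ to the boundary of $f(\mathbb{D})$. $\mathcal{H}_0$ is the class of complex-valued harmonic functions $f=h+\bar g$ on $\mathbb{D}$ with $h(z)=z+\sum_{m=2}^\infty a_mz^m$ and $g(z)=\sum_{m=2}^\infty b_mz^m$ analytic in $\mathbb{D}$. Such an $f$ is sense-preserving if its Jacobian $|h'|^2-|g'|^2$ is positive on $\mathbb{D}$. For fixed sequences $(\gamma_m),(\delta_m)$ as in the claim, $\mathcal{S}^0_{h+\bar g}(M)$ is the class of sense-preserving $f=h+\bar g\in\mathcal{H}_0$ with $\sum_{m=2}^\infty(\gamma_m|a_m|+\delta_m|b_m|)\le M$. The Bohr radius is the largest $r^*\in(0,1]$ such that the displayed inequality holds for all $|z|=r\le r^*$.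
   Formalization: The claim that r* is the Bohr radius and is achieved by z−(M/α_2)z² is stated for M/α_2≤1/2 only (beyond that f is not sense-preserving and equality at r* fails); f is said to lie in the class only if γ_2≤δ_2, since otherwise its weighted sum exceeds M. *)

theory Defs
  imports "HOL-Complex_Analysis.Complex_Analysis"
begin

text \<open>
  A member of the class of harmonic functions \<open>f = h + cnj g\<close> is handled together with its
  coefficient sequences \<open>a\<close>, \<open>b\<close>, which \<open>f\<close> determines uniquely at the indices \<open>m \<ge> 2\<close>; values at
  \<open>m < 2\<close> are irrelevant.  Series over \<open>m \<ge> 2\<close> are unconditional sums over \<open>{2..}\<close>.  For a power
  series that converges on all of the open disc, and for series of nonnegative terms, this agrees
  with ordinary convergence.
\<close>

definition H0_decomp ::
  "(nat \<Rightarrow> complex) \<Rightarrow> (nat \<Rightarrow> complex) \<Rightarrow> (complex \<Rightarrow> complex) \<Rightarrow> (complex \<Rightarrow> complex) \<Rightarrow> bool" where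
  "H0_decomp a b h g \<longleftrightarrow>
     h holomorphic_on ball 0 1 \<and> g holomorphic_on ball 0 1 \<and>
     (\<forall>z\<in>ball 0 1. ((\<lambda>m. a m * z ^ m) has_sum (h z - z)) {2..} \<and>
                   ((\<lambda>m. b m * z ^ m) has_sum g z) {2..})"

definition sense_preserving :: "(complex \<Rightarrow> complex) \<Rightarrow> (complex \<Rightarrow> complex) \<Rightarrow> bool" where
  "sense_preserving h g \<longleftrightarrow>
     (\<forall>z\<in>ball 0 1. (cmod (deriv h z))\<^sup>2 - (cmod (deriv g z))\<^sup>2 > 0)"

definition S0 ::
  "(nat \<Rightarrow> real) \<Rightarrow> (nat \<Rightarrow> real) \<Rightarrow> real \<Rightarrow>
   ((nat \<Rightarrow> complex) \<times> (nat \<Rightarrow> complex) \<times> (complex \<Rightarrow> complex)) set" where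
  "S0 \<gamma> \<delta> M = {(a, b, f). \<exists>h g.
     H0_decomp a b h g \<and> (\<forall>z\<in>ball 0 1. f z = h z + cnj (g z)) \<and> sense_preserving h g \<and>
     (\<lambda>m. \<gamma> m * cmod (a m) + \<delta> m * cmod (b m)) summable_on {2..} \<and>
     (\<Sum>\<^sub>\<infinity>m\<in>{2..}. \<gamma> m * cmod (a m) + \<delta> m * cmod (b m)) \<le> M}"

definition bohr_sum :: "(nat \<Rightarrow> complex) \<Rightarrow> (nat \<Rightarrow> complex) \<Rightarrow> complex \<Rightarrow> real" where
  "bohr_sum a b z = cmod z + (\<Sum>\<^sub>\<infinity>m\<in>{2..}. (cmod (a m) + cmod (b m)) * cmod z ^ m)"

definition boundary_dist :: "(complex \<Rightarrow> complex) \<Rightarrow> real" where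
  "boundary_dist f = infdist (f 0) (frontier (f ` ball 0 1))"

text \<open>
  The Bohr radius of a family of functions given with their coefficients.  Summability is demanded
  explicitly because \<open>infsum\<close> is 0 for a divergent series, which would make the inequality spuriously
  easy for a family with a divergent series on the unit circle.
\<close>

definition bohr_radii ::
  "((nat \<Rightarrow> complex) \<times> (nat \<Rightarrow> complex) \<times> (complex \<Rightarrow> complex)) set \<Rightarrow> real set" where
  "bohr_radii F = {r. 0 < r \<and> r \<le> 1 \<and> (\<forall>(a, b, f)\<in>F. \<forall>z. cmod z \<le> r \<longrightarrow>
     (\<lambda>m. (cmod (a m) + cmod (b m)) * cmod z ^ m) summable_on {2..} \<and>
     bohr_sum a b z \<le> boundary_dist f)}"

definition is_bohr_radius ::
  "((nat \<Rightarrow> complex) \<times> (nat \<Rightarrow> complex) \<times> (complex \<Rightarrow> complex)) set \<Rightarrow> real \<Rightarrow> bool" where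
  "is_bohr_radius F r \<longleftrightarrow> r \<in> bohr_radii F \<and> (\<forall>s\<in>bohr_radii F. s \<le> r)"

definition extremal ::
  "real \<Rightarrow> (nat \<Rightarrow> complex) \<times> (nat \<Rightarrow> complex) \<times> (complex \<Rightarrow> complex)" where
  "extremal c = ((\<lambda>m. if m = 2 then - of_real c else 0), (\<lambda>m. 0), (\<lambda>z. z - of_real c * z\<^sup>2))"

end

theory Submission imports Defs begin

text \<open>
  Write \<open>c = M / \<alpha>2\<close>.  The coefficient condition gives \<open>\<Sum>m\<ge>2. |a m| + |b m| \<le> c\<close>, so the Bohr sum is at
  most \<open>r + c r\<^sup>2\<close> and \<open>|f z| \<ge> |z| - c |z|\<^sup>2\<close> on the disc.  A map with positive Jacobian is open, so a
  boundary point of the image is a limit of values \<open>f z\<close> with \<open>|z| \<rightarrow> 1\<close>, whence its modulus is at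
  least \<open>1 - c\<close>.  The radius \<open>rstar\<close> is the root of \<open>r + c r\<^sup>2 = 1 - c\<close>.  For sharpness, \<open>z - c z\<^sup>2\<close> and
  \<open>z - c cnj (z\<^sup>2)\<close> are injective on the closed disc when \<open>c \<le> 1/2\<close>, so their value \<open>1 - c\<close> at \<open>1\<close> is a
  boundary point.
\<close>

section \<open>Open mapping and distance to the boundary of the image\<close>

text \<open>The real derivative of \<open>f\<close> at \<open>z\<close> is \<open>v\<close> ->
  \<open>A * v + cnj (B * v)\<close>, whose determinant is the Jacobian. Positivity makes it
  invertible, and an open mapping theorem needing only a right inverse at one point applies.\<close>

lemma harmonic_image_interior:
  fixes h g f :: "complex \<Rightarrow> complex"
  assumes "open S" "T \<subseteq> S" "z \<in> interior T"
    and hol: "h holomorphic_on S" "g holomorphic_on S"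
    and f: "\<And>w. w \<in> S \<Longrightarrow> f w = h w + cnj (g w)"
    and jac: "(cmod (deriv h z))\<^sup>2 - (cmod (deriv g z))\<^sup>2 > 0"
  shows "f z \<in> interior (f ` T)"
proof -
  have z: "z \<in> S" using assms interior_subset by blast
  define A B J where "A = deriv h z" and "B = deriv g z" and "J = A * cnj A - B * cnj B"
  have "J = of_real ((cmod A)\<^sup>2 - (cmod B)\<^sup>2)"
    by (simp only: J_def complex_norm_square of_real_diff)
  then have J: "J \<noteq> 0" "cnj J = J"
    using jac by (auto simp: A_def B_def simp del: of_real_diff)
  have "(h has_derivative (*) A) (at z)" "(g has_derivative (*) B) (at z)"
    using holomorphic_derivI[OF hol(1) \<open>open S\<close> z] holomorphic_derivI[OF hol(2) \<open>open S\<close> z]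
    by (simp_all add: has_field_derivative_def A_def B_def)
  then have "((\<lambda>w. h w + cnj (g w)) has_derivative (\<lambda>v. A * v + cnj (B * v))) (at z)"
    by (intro has_derivative_add bounded_linear.has_derivative[OF bounded_linear_cnj]) auto
  then have der: "(f has_derivative (\<lambda>v. A * v + cnj (B * v))) (at z)"
    by (rule has_derivative_transform_within_open[OF _ \<open>open S\<close> z]) (simp add: f)
  have "continuous_on S (\<lambda>w. h w + cnj (g w))"
    using hol by (intro continuous_intros holomorphic_on_imp_continuous_on)
  then have cont: "continuous_on S f"
    by (rule continuous_on_eq) (simp add: f)
  \<comment> \<open>Cramer's rule for \<open>A * v + cnj (B * v) = w\<close> together with its
    conjugate; the determinant of this system in \<open>v\<close> and \<open>cnj v\<close> is
    \<open>J\<close>.\<close>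
  define inverse_map where "inverse_map w = (cnj A / J) * w - (cnj B / J) * cnj w" for w
  have lin: "bounded_linear inverse_map"
    unfolding inverse_map_def
    by (intro bounded_linear_sub bounded_linear_mult_right
        bounded_linear_compose[OF bounded_linear_mult_right bounded_linear_cnj])
  have "A * inverse_map w + cnj (B * inverse_map w) = w" for w
  proof -
    have "A * inverse_map w + cnj (B * inverse_map w) = J * w / J"
      using J(1) by (simp add: inverse_map_def J(2) divide_simps) (simp add: J_def algebra_simps)
    then show ?thesis using J(1) by simp
  qed
  then have inv: "(\<lambda>v. A * v + cnj (B * v)) \<circ> inverse_map = id" by auto
  show ?thesis
    by (rule sussmann_open_mapping[OF \<open>open S\<close> cont z der lin inv assms(2,3)])
qed

lemma infdist_frontier_image_ge:
  fixes f :: "complex \<Rightarrow> complex"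
  assumes cont: "continuous_on (ball 0 1) f"
    and "open (f ` ball 0 1)" "f 0 = 0" "c \<ge> 0"
    and lower: "\<And>z. z \<in> ball 0 1 \<Longrightarrow> cmod z - c * (cmod z)\<^sup>2 \<le> cmod (f z)"
    and upper: "\<And>z. z \<in> ball 0 1 \<Longrightarrow> cmod (f z) \<le> K"
  shows "1 - c \<le> infdist (f 0) (frontier (f ` ball 0 1))"
proof -
  let ?D = "ball 0 1 :: complex set"
  \<comment> \<open>The upper bound serves to make the frontier nonempty: \<open>infdist\<close> to
    the empty set is 0.\<close>
  have "bounded (f ` ?D)" by (intro boundedI[of _ K]) (use upper in auto)
  then have "f ` ?D \<noteq> UNIV" by (metis not_bounded_UNIV)
  then have "frontier (f ` ?D) \<noteq> {}" by (simp add: frontier_eq_empty)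
  moreover have "1 - c \<le> cmod w" if w: "w \<in> frontier (f ` ?D)" for w
  proof -
    \<comment> \<open>The image of the compact disc of radius \<open>r\<close> is closed and lies in
      the open image, so it misses \<open>w\<close>. Hence \<open>w\<close> is a limit of values on
      the outer annulus, where \<open>cmod (f z)\<close> is at least \<open>r - c\<close>. Finally
      \<open>r\<close> tends to 1.\<close>
    have "r \<le> cmod w + c" if r: "0 < r" "r < 1" for r
    proof -
      have "f ` ?D = f ` cball 0 r \<union> f ` (?D - cball 0 r)" using r by fastforce
      then have "w \<in> closure (f ` cball 0 r) \<union> closure (f ` (?D - cball 0 r))"
        using w by (metis DiffD1 closure_Un frontier_def)
      moreover have "closure (f ` cball 0 r) = f ` cball 0 r"
        using r by (intro closure_closed compact_imp_closed compact_continuous_image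
            continuous_on_subset[OF cont]) auto
      moreover have "w \<notin> f ` ?D"
        using w assms(2) by (simp add: frontier_def interior_open)
      then have "w \<notin> f ` cball 0 r" using r by auto
      ultimately have "w \<in> closure (f ` (?D - cball 0 r))" by blast
      moreover have "f ` (?D - cball 0 r) \<subseteq> {v. r - c \<le> cmod v}"
      proof clarsimp
        fix z :: complex assume z: "cmod z < 1" "\<not> cmod z \<le> r"
        have "c * (cmod z)\<^sup>2 \<le> c * 1"
          using z \<open>c \<ge> 0\<close> by (intro mult_left_mono power_le_one) auto
        then show "r - c \<le> cmod (f z)" using lower[of z] z by simp
      qed
      moreover have "closed {v :: complex. r - c \<le> cmod v}"
        by (intro closed_Collect_le continuous_intros)
      ultimately have "w \<in> {v. r - c \<le> cmod v}" using closure_minimal by blast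
      then show ?thesis by simp
    qed
    then have "1 \<le> cmod w + c" by (intro dense_le_bounded[of 0 1]) auto
    then show ?thesis by simp
  qed
  ultimately show ?thesis
    by (auto simp: infdist_notempty \<open>f 0 = 0\<close> intro!: cINF_greatest)
qed

lemma infdist_frontier_quadratic_le:
  fixes f \<phi> :: "complex \<Rightarrow> complex"
  assumes "bounded_linear \<phi>" "\<And>z. cmod (\<phi> z) = cmod z" "\<phi> 1 = 1"
    and "c > 0" "c \<le> 1 / 2"
    and f: "\<And>z. f z = z - of_real c * \<phi> (z\<^sup>2)"
  shows "infdist (f 0) (frontier (f ` ball 0 1)) \<le> 1 - c"
proof -
  interpret \<phi>: bounded_linear \<phi> by fact
  \<comment> \<open>Equality would force \<open>c * cmod (1 + z) = 1\<close>, but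
    \<open>cmod (1 + z) < 2\<close> and \<open>c\<close> is at most 1/2.\<close>
  have "f 1 \<noteq> f z" if z: "cmod z < 1" for z
  proof
    assume "f 1 = f z"
    then have "1 - z = of_real c * \<phi> (1\<^sup>2 - z\<^sup>2)"
      by (simp add: f \<phi>.diff algebra_simps)
    then have "cmod (1 - z) = c * cmod (1\<^sup>2 - z\<^sup>2)"
      using \<open>c > 0\<close> by (simp only: norm_mult assms(2)) simp
    also have "1\<^sup>2 - z\<^sup>2 = (1 - z) * (1 + z)"
      by (simp add: power2_eq_square algebra_simps)
    finally have "cmod (1 - z) = c * cmod ((1 - z) * (1 + z))" .
    moreover have "z \<noteq> 1" using z by auto
    ultimately have "1 = c * cmod (1 + z)" by (simp add: norm_mult)
    moreover have "cmod (1 + z) < 2" using norm_triangle_ineq[of 1 z] z by simp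
    then have "c * cmod (1 + z) < c * 2" using \<open>c > 0\<close> by simp
    ultimately show False using \<open>c \<le> 1 / 2\<close> by simp
  qed
  then have "f 1 \<notin> interior (f ` ball 0 1)" using interior_subset by fastforce
  moreover have "continuous_on UNIV f"
    unfolding f by (intro continuous_intros \<phi>.continuous_on)
  then have "f ` closure (ball 0 1) \<subseteq> closure (f ` ball 0 1)"
    by (intro continuous_image_closure_subset[of UNIV]) auto
  then have "f 1 \<in> closure (f ` ball 0 1)" by auto
  ultimately have "f 1 \<in> frontier (f ` ball 0 1)" by (simp add: frontier_def)
  then have "infdist (f 0) (frontier (f ` ball 0 1)) \<le> dist (f 0) (f 1)"
    by (rule infdist_le)
  also have "\<dots> = cmod (of_real (1 - c))"
    by (simp add: f \<phi>.zero assms(3) dist_norm norm_minus_commute)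
  also have "\<dots> = 1 - c"
    using \<open>c \<le> 1 / 2\<close> by (simp only: norm_of_real)
  finally show ?thesis .
qed

section \<open>Coefficient estimates for the class\<close>

text \<open>For \<open>cmod z\<close> at most 1, every power with exponent at least 2 is bounded by
  the square, which then factors out of the sum.\<close>

lemma bohr_sum_le:
  assumes A: "(\<lambda>m. cmod (a m) + cmod (b m)) summable_on {2..}"
      "(\<Sum>\<^sub>\<infinity>m\<in>{2..}. cmod (a m) + cmod (b m)) \<le> c"
    and "cmod z \<le> 1"
  shows "(\<lambda>m. (cmod (a m) + cmod (b m)) * cmod z ^ m) summable_on {2..}"
    and "bohr_sum a b z \<le> cmod z + c * (cmod z)\<^sup>2"
proof -
  have le: "(cmod (a m) + cmod (b m)) * cmod z ^ m \<le> (cmod (a m) + cmod (b m)) * (cmod z)\<^sup>2"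
    if "m \<in> {2..}" for m
    using that assms(3) by (intro mult_left_mono power_decreasing) auto
  have s: "(\<lambda>m. (cmod (a m) + cmod (b m)) * (cmod z)\<^sup>2) summable_on {2..}"
    by (intro summable_on_cmult_left A)
  show sum: "(\<lambda>m. (cmod (a m) + cmod (b m)) * cmod z ^ m) summable_on {2..}"
    by (rule summable_on_comparison_test[OF s le]) auto
  have "(\<Sum>\<^sub>\<infinity>m\<in>{2..}. (cmod (a m) + cmod (b m)) * cmod z ^ m)
      \<le> (\<Sum>\<^sub>\<infinity>m\<in>{2..}. (cmod (a m) + cmod (b m)) * (cmod z)\<^sup>2)"
    by (rule infsum_mono[OF sum s le])
  also have "\<dots> = (\<Sum>\<^sub>\<infinity>m\<in>{2..}. cmod (a m) + cmod (b m)) * (cmod z)\<^sup>2"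
    by (rule infsum_cmult_left')
  also have "\<dots> \<le> c * (cmod z)\<^sup>2"
    using A by (intro mult_right_mono) auto
  finally show "bohr_sum a b z \<le> cmod z + c * (cmod z)\<^sup>2"
    by (simp add: bohr_sum_def)
qed

lemma S0_coeff_sum:
  assumes "(a, b, f) \<in> S0 \<gamma> \<delta> M" "\<alpha> > 0"
    and w: "\<And>m. m \<ge> 2 \<Longrightarrow> \<gamma> m \<ge> \<alpha>" "\<And>m. m \<ge> 2 \<Longrightarrow> \<delta> m \<ge> \<alpha>"
  shows "(\<lambda>m. cmod (a m) + cmod (b m)) summable_on {2..}"
    and "(\<Sum>\<^sub>\<infinity>m\<in>{2..}. cmod (a m) + cmod (b m)) \<le> M / \<alpha>"
proof -
  have s: "(\<lambda>m. \<gamma> m * cmod (a m) + \<delta> m * cmod (b m)) summable_on {2..}"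
    and M: "(\<Sum>\<^sub>\<infinity>m\<in>{2..}. \<gamma> m * cmod (a m) + \<delta> m * cmod (b m)) \<le> M"
    using assms(1) by (auto simp: S0_def)
  have le: "\<alpha> * (cmod (a m) + cmod (b m)) \<le> \<gamma> m * cmod (a m) + \<delta> m * cmod (b m)"
    if "m \<in> {2..}" for m
    using that w by (simp add: distrib_left add_mono mult_right_mono)
  have s': "(\<lambda>m. \<alpha> * (cmod (a m) + cmod (b m))) summable_on {2..}"
    using \<open>\<alpha> > 0\<close> by (intro summable_on_comparison_test[OF s le]) auto
  then show "(\<lambda>m. cmod (a m) + cmod (b m)) summable_on {2..}"
    using \<open>\<alpha> > 0\<close> summable_on_cmult_right'[of \<alpha> "\<lambda>m. cmod (a m) + cmod (b m)" "{2..}"] by simp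
  have "\<alpha> * (\<Sum>\<^sub>\<infinity>m\<in>{2..}. cmod (a m) + cmod (b m)) \<le> M"
    using infsum_mono[OF s' s le] M by (simp add: infsum_cmult_right')
  then show "(\<Sum>\<^sub>\<infinity>m\<in>{2..}. cmod (a m) + cmod (b m)) \<le> M / \<alpha>"
    using \<open>\<alpha> > 0\<close> by (simp add: field_simps)
qed

text \<open>The deviation \<open>f z - z\<close> is dominated by the tail of the Bohr sum, hence by
  \<open>c * (cmod z)\<^sup>2\<close>. This yields both growth bounds and \<open>f 0 = 0\<close>;
  the positive Jacobian yields openness of the image.\<close>

lemma S0_boundary_dist_ge:
  assumes mem: "(a, b, f) \<in> S0 \<gamma> \<delta> M"
    and A: "(\<lambda>m. cmod (a m) + cmod (b m)) summable_on {2..}"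
      "(\<Sum>\<^sub>\<infinity>m\<in>{2..}. cmod (a m) + cmod (b m)) \<le> c"
  shows "1 - c \<le> boundary_dist f"
proof -
  let ?D = "ball 0 1 :: complex set"
  obtain h g where hol: "h holomorphic_on ?D" "g holomorphic_on ?D"
    and ser: "\<And>z. z \<in> ?D \<Longrightarrow> ((\<lambda>m. a m * z ^ m) has_sum (h z - z)) {2..}"
      "\<And>z. z \<in> ?D \<Longrightarrow> ((\<lambda>m. b m * z ^ m) has_sum g z) {2..}"
    and f: "\<And>z. z \<in> ?D \<Longrightarrow> f z = h z + cnj (g z)"
    and jac: "\<And>z. z \<in> ?D \<Longrightarrow> (cmod (deriv h z))\<^sup>2 - (cmod (deriv g z))\<^sup>2 > 0"
    using mem by (auto simp: S0_def H0_decomp_def sense_preserving_def)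
  have "0 \<le> (\<Sum>\<^sub>\<infinity>m\<in>{2..}. cmod (a m) + cmod (b m))" by (intro infsum_nonneg) auto
  then have c: "c \<ge> 0" using A by linarith
  have dev: "cmod (f z - z) \<le> c * (cmod z)\<^sup>2" if z: "z \<in> ?D" for z
  proof -
    have "((\<lambda>m. a m * z ^ m + cnj (b m * z ^ m)) has_sum ((h z - z) + cnj (g z))) {2..}"
      using ser[OF z] by (intro has_sum_add) (simp_all only: has_sum_cnj_iff)
    moreover have "((\<lambda>m. (cmod (a m) + cmod (b m)) * cmod z ^ m) has_sum
        (bohr_sum a b z - cmod z)) {2..}"
      using bohr_sum_le(1)[OF A, of z] z by (simp add: bohr_sum_def has_sum_infsum)
    moreover have "cmod (a m * z ^ m + cnj (b m * z ^ m)) \<le> (cmod (a m) + cmod (b m)) * cmod z ^ m"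
      for m
      using norm_triangle_ineq[of "a m * z ^ m" "cnj (b m * z ^ m)"]
      by (simp add: norm_mult norm_power distrib_right)
    ultimately have "cmod ((h z - z) + cnj (g z)) \<le> bohr_sum a b z - cmod z"
      by (rule norm_infsum_le)
    also have "\<dots> \<le> c * (cmod z)\<^sup>2" using bohr_sum_le(2)[OF A, of z] z by simp
    finally show ?thesis using f[OF z] by (simp add: algebra_simps)
  qed
  have "continuous_on ?D (\<lambda>w. h w + cnj (g w))"
    using hol by (intro continuous_intros holomorphic_on_imp_continuous_on)
  then have cont: "continuous_on ?D f"
    by (rule continuous_on_eq) (simp add: f)
  have "f z \<in> interior (f ` ?D)" if "z \<in> ?D" for z
    using that by (intro harmonic_image_interior[OF open_ball order_refl _ hol f jac]) auto
  then have op: "open (f ` ?D)"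
    by (metis image_subsetI interior_eq interior_subset subset_antisym)
  have lower: "cmod z - c * (cmod z)\<^sup>2 \<le> cmod (f z)" if "z \<in> ?D" for z
    using dev[OF that] norm_triangle_ineq3[of "f z" z] by linarith
  have upper: "cmod (f z) \<le> 1 + c" if z: "z \<in> ?D" for z
  proof -
    have "c * (cmod z)\<^sup>2 \<le> c * 1"
      using z c by (intro mult_left_mono power_le_one) auto
    then show ?thesis
      using dev[OF z] z norm_triangle_ineq3[of "f z" z] by simp
  qed
  have "f 0 = 0" using dev[of 0] by simp
  from infdist_frontier_image_ge[OF cont op this c lower upper]
  show ?thesis by (simp add: boundary_dist_def)
qed

section \<open>Membership of the two extremal functions\<close>

lemma S0I:
  assumes "H0_decomp a b h g" "sense_preserving h g"
    and "\<And>z. z \<in> ball 0 1 \<Longrightarrow> f z = h z + cnj (g z)"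
    and "((\<lambda>m. \<gamma> m * cmod (a m) + \<delta> m * cmod (b m)) has_sum s) {2..}" "s \<le> M"
  shows "(a, b, f) \<in> S0 \<gamma> \<delta> M"
  using assms has_sum_imp_summable[OF assms(4)] infsumI[OF assms(4)]
  unfolding S0_def by blast

text \<open>Here \<open>g = 0\<close>, so sense preservation amounts to \<open>1 - 2 * c * z\<close>
  having no zero in the disc, which is where \<open>c \<le> 1 / 2\<close> enters.\<close>

lemma extremal_in_S0:
  assumes "0 < c" "c \<le> 1 / 2" "\<gamma> 2 * c \<le> M"
  shows "extremal c \<in> S0 \<gamma> \<delta> M"
proof -
  let ?a = "\<lambda>m::nat. if m = 2 then - of_real c else 0 :: complex"
  let ?h = "\<lambda>z::complex. z - of_real c * z\<^sup>2"
  have "H0_decomp ?a (\<lambda>m. 0) ?h (\<lambda>z. 0)"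
    unfolding H0_decomp_def
    by (auto intro!: holomorphic_intros has_sum_finite_neutralI[where B = "{2}"] split: if_splits)
  moreover have "sense_preserving ?h (\<lambda>z. 0)"
    unfolding sense_preserving_def
  proof
    fix z :: complex assume z: "z \<in> ball 0 1"
    have "(?h has_field_derivative 1 - of_real c * (2 * z)) (at z)"
      by (auto intro!: derivative_eq_intros)
    then have d: "deriv ?h z = 1 - of_real c * (2 * z)" by (rule DERIV_imp_deriv)
    have "cmod (of_real c * (2 * z)) = 2 * c * cmod z" using assms by (simp add: norm_mult)
    also have "\<dots> \<le> 1 * cmod z" using assms by (intro mult_right_mono) auto
    also have "\<dots> < 1" using z by simp
    finally have "deriv ?h z \<noteq> 0" using d by auto
    then show "(cmod (deriv ?h z))\<^sup>2 - (cmod (deriv (\<lambda>z. 0) z))\<^sup>2 > 0" by simp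
  qed
  moreover have "((\<lambda>m. \<gamma> m * cmod (?a m) + \<delta> m * cmod 0) has_sum \<gamma> 2 * c) {2..}"
    using assms by (intro has_sum_finite_neutralI[where B = "{2}"]) auto
  ultimately show ?thesis
    unfolding extremal_def by (intro S0I[OF _ _ _ _ assms(3)]) auto
qed

text \<open>The counterpart for the case where \<delta> has the smaller weight at 2: the quadratic
  term moves to the antiholomorphic part. The Jacobian is one minus the square of
  \<open>2 * c * cmod z\<close>.\<close>

lemma coextremal_in_S0:
  assumes "0 < c" "c \<le> 1 / 2" "\<delta> 2 * c \<le> M"
  shows "((\<lambda>m. 0), (\<lambda>m. if m = 2 then - of_real c else 0), (\<lambda>z. z - of_real c * cnj (z\<^sup>2)))
    \<in> S0 \<gamma> \<delta> M"
proof -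
  let ?b = "\<lambda>m::nat. if m = 2 then - of_real c else 0 :: complex"
  let ?g = "\<lambda>z::complex. - of_real c * z\<^sup>2"
  have "H0_decomp (\<lambda>m. 0) ?b (\<lambda>z. z) ?g"
    unfolding H0_decomp_def
    by (auto intro!: holomorphic_intros has_sum_finite_neutralI[where B = "{2}"] split: if_splits)
  moreover have "sense_preserving (\<lambda>z. z) ?g"
    unfolding sense_preserving_def
  proof
    fix z :: complex assume z: "z \<in> ball 0 1"
    have "(?g has_field_derivative - of_real c * (2 * z)) (at z)"
      by (auto intro!: derivative_eq_intros)
    then have d: "deriv ?g z = - of_real c * (2 * z)" by (rule DERIV_imp_deriv)
    have "cmod (deriv ?g z) = 2 * c * cmod z" using assms d by (simp add: norm_mult)
    also have "\<dots> \<le> 1 * cmod z" using assms by (intro mult_right_mono) auto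
    also have "\<dots> < 1" using z by simp
    finally show "(cmod (deriv (\<lambda>z. z) z))\<^sup>2 - (cmod (deriv ?g z))\<^sup>2 > 0"
      by (simp add: abs_square_less_1)
  qed
  moreover have "((\<lambda>m. \<gamma> m * cmod 0 + \<delta> m * cmod (?b m)) has_sum \<delta> 2 * c) {2..}"
    using assms by (intro has_sum_finite_neutralI[where B = "{2}"]) auto
  ultimately show ?thesis
    by (intro S0I[OF _ _ _ _ assms(3)]) auto
qed

section \<open>Extremal Bohr sums and the equation for the radius\<close>

lemma bohr_sum_single:
  assumes "\<And>m. cmod (a m) + cmod (b m) = (if m = 2 then c else 0)"
  shows "bohr_sum a b z = cmod z + c * (cmod z)\<^sup>2"
  using assms unfolding bohr_sum_def
  by (auto intro!: infsumI has_sum_finite_neutralI[where B = "{2}"] split: if_splits)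

text \<open>
  For \<open>c > 1\<close> the radicand may be negative; \<open>sqrt\<close> is then negative as well, and \<open>r < 0\<close> in either case.
\<close>

lemma quadratic_root:
  fixes c r :: real
  assumes "c > 0" and r: "r = (-1 + sqrt (1 + 4 * c * (1 - c))) / (2 * c)"
  shows "c \<le> 1 \<Longrightarrow> r + c * r\<^sup>2 = 1 - c" and "c < 1 \<Longrightarrow> 0 < r" and "0 \<le> r \<Longrightarrow> c \<le> 1"
proof -
  let ?q = "sqrt (1 + 4 * c * (1 - c))"
  \<comment> \<open>This is the formula for \<open>r\<close> solved for the root; the sign of
    \<open>r\<close> is thereby decided by comparing \<open>?q\<close> with 1.\<close>
  have q: "?q = 2 * c * r + 1" using assms by (simp add: r)
  show "r + c * r\<^sup>2 = 1 - c" if "c \<le> 1"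
  proof -
    \<comment> \<open>Squaring undoes \<open>sqrt\<close> because \<open>c \<le> 1\<close> makes the
      radicand nonnegative.\<close>
    have "?q\<^sup>2 = 1 + 4 * c * (1 - c)" using that \<open>c > 0\<close> by simp
    then have "4 * c * (r + c * r\<^sup>2) = 4 * c * (1 - c)"
      unfolding q by (simp add: power2_eq_square algebra_simps)
    then show ?thesis using \<open>c > 0\<close> by simp
  qed
  show "0 < r" if "c < 1"
  proof -
    have "?q > 1" using that \<open>c > 0\<close> by simp
    then show ?thesis using \<open>c > 0\<close> by (simp add: r)
  qed
  show "c \<le> 1" if "0 \<le> r"
  proof -
    have "?q \<ge> 1" using that \<open>c > 0\<close> by (simp add: q)
    then show ?thesis using \<open>c > 0\<close> by (simp add: zero_le_mult_iff)
  qed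
qed

text \<open>Since \<open>s + c * s\<^sup>2\<close> is strictly increasing for positive
  \<open>s\<close>, a single member with this Bohr sum and boundary distance at most
  \<open>1 - c\<close> excludes every radius above \<open>r\<close>.\<close>

lemma is_bohr_radiusI:
  assumes "c > 0" "0 < r" "r \<le> 1" "r + c * r\<^sup>2 = 1 - c"
    and bound: "\<And>a b f z. \<lbrakk>(a, b, f) \<in> F; cmod z \<le> r\<rbrakk> \<Longrightarrow>
      (\<lambda>m. (cmod (a m) + cmod (b m)) * cmod z ^ m) summable_on {2..} \<and>
      bohr_sum a b z \<le> boundary_dist f"
    and ext: "(a, b, f) \<in> F" "\<And>z. bohr_sum a b z = cmod z + c * (cmod z)\<^sup>2"
      "boundary_dist f \<le> 1 - c"
  shows "is_bohr_radius F r"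
  unfolding is_bohr_radius_def
proof
  show "r \<in> bohr_radii F"
    using assms(2,3) bound by (auto simp: bohr_radii_def)
  show "\<forall>s\<in>bohr_radii F. s \<le> r"
  proof
    fix s assume s: "s \<in> bohr_radii F"
    then have "0 < s" by (simp add: bohr_radii_def)
    then have "bohr_sum a b (of_real s) \<le> boundary_dist f"
      using s ext(1) by (fastforce simp: bohr_radii_def)
    then have *: "s + c * s\<^sup>2 \<le> r + c * r\<^sup>2"
      using \<open>0 < s\<close> ext(2,3) assms(4) by simp
    show "s \<le> r"
    proof (rule ccontr)
      assume "\<not> s \<le> r"
      then have "c * r\<^sup>2 \<le> c * s\<^sup>2"
        using \<open>0 < r\<close> \<open>c > 0\<close> by (intro mult_left_mono power_mono) auto
      then show False using * \<open>\<not> s \<le> r\<close> by linarith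
    qed
  qed
qed

section \<open>The Bohr inequality and its sharpness\<close>

theorem theorem2p3:
  fixes M \<alpha>2 rstar :: real and \<gamma> \<delta> :: "nat \<Rightarrow> real"
  assumes "M > 0"
    and "\<alpha>2 = min (\<gamma> 2) (\<delta> 2)" and "\<alpha>2 > 0"
    and "\<forall>m\<ge>2. \<gamma> m \<ge> \<alpha>2 \<and> \<delta> m \<ge> \<alpha>2"
    and "rstar = (-1 + sqrt (1 + 4 * (M / \<alpha>2) * (1 - M / \<alpha>2))) / (2 * (M / \<alpha>2))"
  shows "(\<forall>a b f z. (a, b, f) \<in> S0 \<gamma> \<delta> M \<and> cmod z \<le> rstar \<longrightarrow>
            (\<lambda>m. (cmod (a m) + cmod (b m)) * cmod z ^ m) summable_on {2..} \<and>
            cmod z + (\<Sum>\<^sub>\<infinity>m\<in>{2..}. (cmod (a m) + cmod (b m)) * cmod z ^ m)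
              \<le> infdist (f 0) (frontier (f ` ball 0 1)))
    \<and> (M / \<alpha>2 \<le> 1 / 2 \<longrightarrow>
         is_bohr_radius (S0 \<gamma> \<delta> M) rstar \<and>
         (\<gamma> 2 \<le> \<delta> 2 \<longrightarrow> extremal (M / \<alpha>2) \<in> S0 \<gamma> \<delta> M) \<and>
         is_bohr_radius {extremal (M / \<alpha>2)} rstar \<and>
         (\<forall>a b f z. (a, b, f) = extremal (M / \<alpha>2) \<and> cmod z = rstar \<longrightarrow>
            bohr_sum a b z = boundary_dist f))"
proof -
  define c where "c = M / \<alpha>2"
  have c: "c > 0" using assms by (simp add: c_def)
  have r: "rstar = (-1 + sqrt (1 + 4 * c * (1 - c))) / (2 * c)"
    using assms(5) by (simp add: c_def)
  note root = quadratic_root[OF c r]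
  \<comment> \<open>The weights are kept general so that the bound also applies to the constant
    weights \<alpha>2, needed for the extremal function.\<close>
  have main: "(\<lambda>m. (cmod (a m) + cmod (b m)) * cmod z ^ m) summable_on {2..} \<and>
      bohr_sum a b z \<le> boundary_dist f"
    if mem: "(a, b, f) \<in> S0 \<gamma>' \<delta>' M" and z: "cmod z \<le> rstar"
      and w: "\<And>m. m \<ge> 2 \<Longrightarrow> \<gamma>' m \<ge> \<alpha>2" "\<And>m. m \<ge> 2 \<Longrightarrow> \<delta>' m \<ge> \<alpha>2" for a b f z \<gamma>' \<delta>'
  proof -
    note A = S0_coeff_sum[OF mem assms(3) w, folded c_def]
    \<comment> \<open>The mere existence of \<open>z\<close> makes \<open>rstar\<close> nonnegative
      and so \<open>c \<le> 1\<close>; for larger \<open>c\<close> the claim is vacuous.\<close>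
    have r0: "0 \<le> rstar" using z norm_ge_zero[of z] by linarith
    note c1 = root(3)[OF r0]
    have "0 \<le> c * rstar\<^sup>2" using c by simp
    then have "rstar \<le> 1" using root(1)[OF c1] c by linarith
    then have z1: "cmod z \<le> 1" using z by simp
    have "c * (cmod z)\<^sup>2 \<le> c * rstar\<^sup>2"
      using z c by (intro mult_left_mono power_mono) auto
    then have "bohr_sum a b z \<le> 1 - c"
      using bohr_sum_le(2)[OF A z1] z root(1)[OF c1] by linarith
    then show ?thesis
      using bohr_sum_le(1)[OF A z1] S0_boundary_dist_ge[OF mem A] by linarith
  qed
  have w: "\<And>m. m \<ge> 2 \<Longrightarrow> \<gamma> m \<ge> \<alpha>2" "\<And>m. m \<ge> 2 \<Longrightarrow> \<delta> m \<ge> \<alpha>2"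
    using assms(4) by auto
  \<comment> \<open>For \<open>c > 1 / 2\<close> the derivative of \<open>z - c * z\<^sup>2\<close>
    vanishes at \<open>1 / (2 * c)\<close> inside the disc, so this function is no longer
    sense-preserving.\<close>
  have sharp: "is_bohr_radius (S0 \<gamma> \<delta> M) rstar \<and>
      (\<gamma> 2 \<le> \<delta> 2 \<longrightarrow> extremal c \<in> S0 \<gamma> \<delta> M) \<and>
      is_bohr_radius {extremal c} rstar \<and>
      (\<forall>a b f z. (a, b, f) = extremal c \<and> cmod z = rstar \<longrightarrow> bohr_sum a b z = boundary_dist f)"
    if ch: "c \<le> 1 / 2"
  proof -
    obtain a b f where e: "extremal c = (a, b, f)" by (cases "extremal c")
    have e': "a = (\<lambda>m. if m = 2 then - of_real c else 0)" "b = (\<lambda>m. 0)"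
      "f = (\<lambda>z. z - of_real c * z\<^sup>2)"
      using e by (simp_all add: extremal_def)
    have bs: "bohr_sum a b z = cmod z + c * (cmod z)\<^sup>2" for z
      using c by (intro bohr_sum_single) (simp add: e')
    have bd: "boundary_dist f \<le> 1 - c"
      unfolding boundary_dist_def using c ch
      by (intro infdist_frontier_quadratic_le[where \<phi> = "\<lambda>z. z"]) (auto simp: e')
    \<comment> \<open>If \<open>\<delta> 2 < \<gamma> 2\<close>, the extremal function may lie outside the class of the theorem, but it always
      belongs to the class with constant weights \<open>\<alpha>2\<close>.\<close>
    have mem: "(a, b, f) \<in> S0 (\<lambda>_. \<alpha>2) (\<lambda>_. \<alpha>2) M"
      unfolding e[symmetric] using assms(3) by (intro extremal_in_S0[OF c ch]) (simp add: c_def)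
    have eq: "rstar + c * rstar\<^sup>2 = 1 - c" and rpos: "0 < rstar" using root ch by auto
    have "0 \<le> c * rstar\<^sup>2" using c by simp
    then have r1: "rstar \<le> 1" using eq c by linarith
    have mem': "extremal c \<in> S0 \<gamma> \<delta> M" if "\<gamma> 2 \<le> \<delta> 2"
      using that assms(2,3) by (intro extremal_in_S0[OF c ch]) (simp add: c_def)
    have "is_bohr_radius (S0 \<gamma> \<delta> M) rstar"
    proof (cases "\<gamma> 2 \<le> \<delta> 2")
      case True
      with mem' e have "(a, b, f) \<in> S0 \<gamma> \<delta> M" by simp
      from is_bohr_radiusI[OF c rpos r1 eq main[OF _ _ w] this bs bd] show ?thesis by simp
    next
      case False
      \<comment> \<open>Now \<alpha>2 is \<open>\<delta> 2\<close>, so a coefficient of modulus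
        \<open>c\<close> placed in \<open>b 2\<close> uses up exactly the budget
        \<open>M\<close>.\<close>
      let ?f = "\<lambda>z. z - of_real c * cnj (z\<^sup>2)"
      have co: "((\<lambda>m. 0), (\<lambda>m. if m = 2 then - of_real c else 0), ?f) \<in> S0 \<gamma> \<delta> M"
        using False assms(2,3) by (intro coextremal_in_S0[OF c ch]) (simp add: c_def)
      have cobs: "bohr_sum (\<lambda>m. 0) (\<lambda>m. if m = 2 then - of_real c else 0) z
          = cmod z + c * (cmod z)\<^sup>2" for z
        using c by (intro bohr_sum_single) simp
      have cobd: "boundary_dist ?f \<le> 1 - c"
        unfolding boundary_dist_def using c ch
        by (intro infdist_frontier_quadratic_le[where \<phi> = cnj]) (auto simp: bounded_linear_cnj)
      from is_bohr_radiusI[OF c rpos r1 eq main[OF _ _ w] co cobs cobd] show ?thesis by simp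
    qed
    moreover have "is_bohr_radius {extremal c} rstar"
    proof (rule is_bohr_radiusI[OF c rpos r1 eq _ _ bs bd])
      show "(a, b, f) \<in> {extremal c}" by (simp add: e)
    next
      fix a' b' f' z assume "(a', b', f') \<in> {extremal c}" "cmod z \<le> rstar"
      then show "(\<lambda>m. (cmod (a' m) + cmod (b' m)) * cmod z ^ m) summable_on {2..} \<and>
          bohr_sum a' b' z \<le> boundary_dist f'"
        using main[OF mem] by (simp add: e)
    qed
    \<comment> \<open>At this radius the Bohr sum equals \<open>1 - c\<close>, which bounds the
      distance from above; the general inequality gives the other direction.\<close>
    moreover have "bohr_sum a b z = boundary_dist f" if "cmod z = rstar" for z
    proof (rule antisym)
      show "bohr_sum a b z \<le> boundary_dist f" using main[OF mem, of z] that by simp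
      show "boundary_dist f \<le> bohr_sum a b z" using bs[of z] bd eq that by simp
    qed
    ultimately show ?thesis using mem' e by auto
  qed
  have "(\<lambda>m. (cmod (a m) + cmod (b m)) * cmod z ^ m) summable_on {2..} \<and>
      bohr_sum a b z \<le> boundary_dist f" if "(a, b, f) \<in> S0 \<gamma> \<delta> M" "cmod z \<le> rstar" for a b f z
    using main[OF that w] .
  then show ?thesis
    using sharp unfolding bohr_sum_def boundary_dist_def c_def by blast
qed

end
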